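(* Let $n\ge1$, let $o=(-1,\dots,-1)\in\{-1,1\}^n$, and define $f_n:\{-1,1\}^n\to\{-1,1\}$ by $f_n(o)=-1$ and $f_n(x)=1$ for $x\ne o$. Then $$\mathsf B(f_n)=\frac{\sqrt n}{2^n}.$$ On the other hand, for the one-sided boundary of $\{f_n=1\}$, equivalently for $\mathsf T_{\rm col}^\chi(f_n)$ with $\chi$ the all-red coloring, $$\mathbb E\sqrt{h_{\{f_n=1\}}}=\frac n{2^n}.$$ Thus $$\frac{\mathbb E\sqrt{h_{\{f_n=1\}}}}{\mathsf B(f_n)}=\sqrt n .$$ Moreover, for the fractional coloring $\theta\equiv1$, $\mathsf T_\theta(f_n)/\mathsf B(f_n)=\sqrt n$.
   Context: $\{-1,1\}^n$ carries the uniform probability measure. $x^{\oplus i}$ is $x$ with the $i$th coordinate flipped. $D_ig(x)=\frac{g(x)-g(x^{\oplus i})}2$, $L=\sum_{i=1}^n D_i$. A vector field is a map $V=(V_1,\dots,V_n):\{-1,1\}^n\to\mathbb R^n$, with $\operatorname{div}V(x)=\sum_{i=1}^n(V_i(x)-V_i(x^{\oplus i}))$. The Beckmann boundary is $\mathsf B(f)=\inf\{\mathbb E\|V(x)\|_2:\operatorname{div}V=Lf\}$ ($\|\cdot\|_2$ Euclidean norm). For $A\subset\{-1,1\}^n$, $h_A(x)=\#\{i:x\in A,\ x^{\oplus i}\notin A\}$. For Boolean $f$ let $E_f$ be the set of sensitive edges, i.e. edges $\{x,x^{\oplus i}\}$ of the cube with $f(x)\ne f(x^{\oplus i})$. For a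 coloring $\chi:E_f\to\{\text{red},\text{blue}\}$ let $s_{f,\rm red}(x)=\#\{i: f(x)=1,\ f(x^{\oplus i})=-1,\ \{x,x^{\oplus i}\}\text{ red}\}$ and $s_{f,\rm blue}(x)=\#\{i: f(x)=-1,\ f(x^{\oplus i})=1,\ \{x,x^{\oplus i}\}\text{ blue}\}$, and $\mathsf T_{\rm col}^\chi(f)=\mathbb E\sqrt{s_{f,\rm red}}+\mathbb E\sqrt{s_{f,\rm blue}}$. For a fractional coloring $\theta:E_f\to[0,1]$ let $$\mathsf T_\theta(f)=\mathbb E_x\Big(\sum_{i:\,f(x)=1,\,f(x^{\oplus i})=-1}\theta_{\{x,x^{\oplus i}\}}^2+\sum_{i:\,f(x)=-1,\,f(x^{\oplus i})=1}(1-\theta_{\{x,x^{\oplus i}\}})^2\Big)^{1/2}.$$ *)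

theory Defs
  imports "HOL-Analysis.Analysis" "HOL-Probability.Probability"
begin

text \<open>The dimension is \<open>n = CARD('n)\<close>. Functions on the discrete cube are represented by
  functions on all of \<open>real ^ 'n\<close>; every notion below depends only on their values on \<open>cube\<close>.\<close>

definition cube :: "(real ^ 'n) set" where
  "cube = {x. \<forall>i. x $ i \<in> {-1, 1}}"

lemma finite_cube: "finite (cube :: (real ^ 'n) set)"
proof -
  have "cube \<subseteq> range (\<lambda>S :: 'n set. \<chi> i. if i \<in> S then 1 else (-1 :: real))"
  proof
    fix x :: "real ^ 'n"
    assume "x \<in> cube"
    then have "x = (\<chi> i. if i \<in> {i. x $ i = 1} then 1 else -1)"
      by (auto simp: cube_def vec_eq_iff)
    then show "x \<in> range (\<lambda>S :: 'n set. \<chi> i. if i \<in> S then 1 else (-1 :: real))"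
      by (rule range_eqI)
  qed
  then show ?thesis
    by (rule finite_subset) simp
qed

lemma cube_nonempty: "cube \<noteq> ({} :: (real ^ 'n) set)"
proof -
  have "(\<chi> i. 1) \<in> (cube :: (real ^ 'n) set)"
    by (simp add: cube_def)
  then show ?thesis
    by blast
qed

definition cube_expectation :: "(real ^ 'n \<Rightarrow> real) \<Rightarrow> real" where
  "cube_expectation g = measure_pmf.expectation (pmf_of_set cube) g"

definition flip :: "'n \<Rightarrow> real ^ 'n \<Rightarrow> real ^ 'n" where
  "flip i x = (\<chi> j. if j = i then - (x $ j) else x $ j)"

lemma flip_in_cube: "x \<in> cube \<Longrightarrow> flip i x \<in> cube"
  by (auto simp: cube_def flip_def)

definition cube_D :: "'n \<Rightarrow> (real ^ 'n \<Rightarrow> real) \<Rightarrow> real ^ 'n \<Rightarrow> real" where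
  "cube_D i g x = (g x - g (flip i x)) / 2"

definition cube_L :: "(real ^ 'n \<Rightarrow> real) \<Rightarrow> real ^ 'n \<Rightarrow> real" where
  "cube_L g x = (\<Sum>i\<in>UNIV. cube_D i g x)"

definition cube_div :: "(real ^ 'n \<Rightarrow> real ^ 'n) \<Rightarrow> real ^ 'n \<Rightarrow> real" where
  "cube_div V x = (\<Sum>i\<in>UNIV. V x $ i - V (flip i x) $ i)"

text \<open>The infimum below is over a nonempty set of nonnegative reals: the field
  \<open>V\<^sub>i = D\<^sub>i f / 2\<close> is always admissible.\<close>

definition beckmann :: "(real ^ 'n \<Rightarrow> real) \<Rightarrow> real" where
  "beckmann f = Inf {cube_expectation (\<lambda>x. norm (V x)) | V.
     \<forall>x\<in>cube. cube_div V x = cube_L f x}"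

definition one_sided_boundary :: "(real ^ 'n) set \<Rightarrow> real ^ 'n \<Rightarrow> nat" where
  "one_sided_boundary A x = card {i. x \<in> A \<and> flip i x \<notin> A}"

definition sensitive_edges :: "(real ^ 'n \<Rightarrow> real) \<Rightarrow> (real ^ 'n) set set" where
  "sensitive_edges f = {{x, flip i x} | x i. x \<in> cube \<and> f x \<noteq> f (flip i x)}"

datatype colour = Red | Blue

text \<open>Colorings are total functions on sets of points, of which only the values on
  \<open>sensitive_edges f\<close> are used.\<close>

definition sens_red :: "((real ^ 'n) set \<Rightarrow> colour) \<Rightarrow> (real ^ 'n \<Rightarrow> real) \<Rightarrow> real ^ 'n \<Rightarrow> nat" where
  "sens_red c f x = card {i. f x = 1 \<and> f (flip i x) = -1 \<and> c {x, flip i x} = Red}"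

definition sens_blue :: "((real ^ 'n) set \<Rightarrow> colour) \<Rightarrow> (real ^ 'n \<Rightarrow> real) \<Rightarrow> real ^ 'n \<Rightarrow> nat" where
  "sens_blue c f x = card {i. f x = -1 \<and> f (flip i x) = 1 \<and> c {x, flip i x} = Blue}"

definition T_col :: "((real ^ 'n) set \<Rightarrow> colour) \<Rightarrow> (real ^ 'n \<Rightarrow> real) \<Rightarrow> real" where
  "T_col c f = cube_expectation (\<lambda>x. sqrt (real (sens_red c f x)))
             + cube_expectation (\<lambda>x. sqrt (real (sens_blue c f x)))"

definition T_frac :: "((real ^ 'n) set \<Rightarrow> real) \<Rightarrow> (real ^ 'n \<Rightarrow> real) \<Rightarrow> real" where
  "T_frac \<theta> f = cube_expectation (\<lambda>x. sqrt (
     (\<Sum>i | f x = 1 \<and> f (flip i x) = -1. (\<theta> {x, flip i x})\<^sup>2)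
   + (\<Sum>i | f x = -1 \<and> f (flip i x) = 1. (1 - \<theta> {x, flip i x})\<^sup>2)))"

definition punctured_cube_fun :: "real ^ 'n \<Rightarrow> real" where
  "punctured_cube_fun x = (if x = (\<chi> i. -1) then -1 else 1)"

end

theory Submission
  imports Defs
begin

text \<open>Write \<open>o\<close> for the point \<open>(-1, \<dots>, -1)\<close>, and \<open>n = CARD('n)\<close>. The sensitive edges of
  \<open>punctured_cube_fun\<close> are the \<open>n\<close> edges at \<open>o\<close>, and the ratio \<open>sqrt n\<close> measures
  the choice of the endpoint that pays for them. Seen from the side of \<open>f = 1\<close>, each of the
  \<open>n\<close> neighbours of \<open>o\<close> carries one edge and contributes \<open>sqrt 1\<close>, in total \<open>n\<close>; seen from
  \<open>o\<close>, a single point carries all \<open>n\<close> edges and contributes only \<open>sqrt n\<close>.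

  For the Beckmann boundary, the field that equals \<open>(-1, \<dots>, -1)\<close> at \<open>o\<close> and vanishes elsewhere
  has divergence \<open>L f\<close> and costs \<open>sqrt n / 2 ^ n\<close>. Optimality is linear programming duality with
  a linear potential \<open>\<psi> x = u \<bullet> x\<close>. Summation by parts moves the divergence
  from an admissible \<open>V\<close> onto \<open>\<psi>\<close>, whose discrete gradient \<open>(2 u\<^sub>i x\<^sub>i)\<^sub>i\<close>
  has the same norm \<open>2 \<parallel>u\<parallel>\<close> at every point of the cube; and \<open>L \<psi> = \<psi>\<close>. So \<open>V\<close> costs at least
  \<open>E (f \<psi>) / (2 \<parallel>u\<parallel>)\<close> (lemma \<open>linear_potential_bound\<close>). For \<open>u = (1, \<dots>, 1)\<close> this matches
  the cost of the explicit field.\<close>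

section \<open>Averages over the cube\<close>

lemma flip_flip [simp]: "flip i (flip i x) = x"
  by (simp add: flip_def vec_eq_iff)

lemma card_cube: "card (cube :: (real ^ 'n) set) = 2 ^ CARD('n)"
proof -
  have "bij_betw (\<lambda>S :: 'n set. \<chi> i. if i \<in> S then 1 else (-1 :: real)) UNIV cube"
    by (rule bij_betw_byWitness[where f' = "\<lambda>x. {i. x $ i = 1}"])
      (force simp: cube_def vec_eq_iff)+
  then have "card (cube :: (real ^ 'n) set) = card (UNIV :: 'n set set)"
    by (rule bij_betw_same_card[symmetric])
  then show ?thesis
    by (metis Pow_UNIV card_Pow finite_class.finite_UNIV)
qed

lemma cube_expectation_eq_sum:
  "cube_expectation (g :: real ^ 'n \<Rightarrow> real) = (\<Sum>x\<in>cube. g x) / 2 ^ CARD('n)"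
  unfolding cube_expectation_def
  by (simp add: integral_pmf_of_set finite_cube cube_nonempty card_cube)

lemma sum_cube_flip: "(\<Sum>x\<in>cube. g (flip i x)) = (\<Sum>x\<in>cube. g x)"
  by (rule sum.reindex_bij_witness[where i = "flip i" and j = "flip i"]) (auto simp: flip_in_cube)

section \<open>Duality with linear potentials\<close>

lemma sum_by_parts:
  "(\<Sum>x\<in>cube. \<psi> x * (g x - g (flip i x))) = (\<Sum>x\<in>cube. g x * (\<psi> x - \<psi> (flip i x)))"
  for \<psi> g :: "real ^ 'n \<Rightarrow> real"
proof -
  have "(\<Sum>x\<in>cube. \<psi> x * g (flip i x)) = (\<Sum>x\<in>cube. \<psi> (flip i x) * g x)"
    using sum_cube_flip[of "\<lambda>x. \<psi> x * g (flip i x)" i] by simp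
  then show ?thesis
    by (simp add: algebra_simps sum_subtractf)
qed

lemma linear_potential_gradient:
  "u \<bullet> x - u \<bullet> flip i x = 2 * (u $ i * x $ i)" for u x :: "real ^ 'n"
proof -
  have "u \<bullet> x - u \<bullet> flip i x = (\<Sum>j\<in>UNIV. if j = i then 2 * (u $ j * x $ j) else 0)"
    unfolding inner_vec_def sum_subtractf[symmetric]
    by (rule sum.cong) (auto simp: flip_def)
  then show ?thesis
    by simp
qed

text \<open>Pairing the equation \<open>div V = L f\<close> with \<open>\<lambda>x. u \<bullet> x\<close> and summing both sides by parts turns it
  into \<open>E (\<Sum>\<^sub>i 2 V\<^sub>i u\<^sub>i x\<^sub>i) = E (f (u \<bullet> x))\<close>. As \<open>x\<^sub>i\<^sup>2 = 1\<close>, the vector \<open>(u\<^sub>i x\<^sub>i)\<^sub>i\<close> is as long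
  as \<open>u\<close>, and the Cauchy--Schwarz inequality finishes.\<close>

lemma linear_potential_bound:
  fixes V :: "real ^ 'n \<Rightarrow> real ^ 'n"
  assumes "\<forall>x\<in>cube. cube_div V x = cube_L f x"
  shows "cube_expectation (\<lambda>x. f x * (u \<bullet> x)) \<le> 2 * norm u * cube_expectation (\<lambda>x. norm (V x))"
proof -
  have "(\<Sum>x\<in>cube. (u \<bullet> x) * cube_L f x)
      = (\<Sum>i\<in>UNIV. (\<Sum>x\<in>cube. (u \<bullet> x) * (f x - f (flip i x))) / 2)"
    unfolding cube_L_def cube_D_def sum_distrib_left sum_divide_distrib
    by (subst sum.swap) simp
  also have "\<dots> = (\<Sum>i\<in>UNIV. \<Sum>x\<in>cube. f x * (u $ i * x $ i))"
    by (subst sum_by_parts) (simp add: linear_potential_gradient sum_divide_distrib)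
  also have "\<dots> = (\<Sum>x\<in>cube. f x * (u \<bullet> x))"
    by (subst sum.swap) (simp add: inner_vec_def sum_distrib_left)
  finally have L: "(\<Sum>x\<in>cube. (u \<bullet> x) * cube_L f x) = (\<Sum>x\<in>cube. f x * (u \<bullet> x))" .
  have "(\<Sum>x\<in>cube. (u \<bullet> x) * cube_div V x)
      = (\<Sum>i\<in>UNIV. \<Sum>x\<in>cube. (u \<bullet> x) * (V x $ i - V (flip i x) $ i))"
    unfolding cube_div_def sum_distrib_left by (rule sum.swap)
  also have "\<dots> = (\<Sum>i\<in>UNIV. \<Sum>x\<in>cube. V x $ i * (2 * (u $ i * x $ i)))"
    by (simp add: sum_by_parts[where g = "\<lambda>x. V x $ _"] linear_potential_gradient)
  also have "\<dots> = (\<Sum>x\<in>cube. 2 * (V x \<bullet> (\<chi> i. u $ i * x $ i)))"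
    by (subst sum.swap) (simp add: inner_vec_def sum_distrib_left mult_ac)
  also have "\<dots> \<le> (\<Sum>x\<in>cube. 2 * norm u * norm (V x))"
  proof (rule sum_mono)
    fix x :: "real ^ 'n"
    assume "x \<in> cube"
    then have "\<bar>x $ i\<bar> = 1" for i
      by (auto simp: cube_def dest: spec[of _ i])
    then have "norm (\<chi> i. u $ i * x $ i) = norm u"
      by (simp add: norm_vec_def abs_mult)
    then show "2 * (V x \<bullet> (\<chi> i. u $ i * x $ i)) \<le> 2 * norm u * norm (V x)"
      using norm_cauchy_schwarz[of "V x" "\<chi> i. u $ i * x $ i"] by (simp add: mult_ac)
  qed
  finally have "(\<Sum>x\<in>cube. f x * (u \<bullet> x)) \<le> 2 * norm u * (\<Sum>x\<in>cube. norm (V x))"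
    using assms L by (simp add: sum_distrib_left)
  then show ?thesis
    by (simp add: cube_expectation_eq_sum divide_right_mono)
qed

section \<open>The Beckmann boundary of the punctured cube\<close>

abbreviation puncture :: "real ^ 'n" where
  "puncture \<equiv> (\<chi> i. -1)"

lemma puncture_in_cube: "puncture \<in> cube"
  by (simp add: cube_def)

lemma norm_const_vec: "norm ((\<chi> i. c) :: real ^ 'n) = sqrt (real CARD('n)) * \<bar>c\<bar>"
  by (simp add: norm_vec_def L2_set_def real_sqrt_mult)

lemma sum_cube_inner: "(\<Sum>x\<in>cube. u \<bullet> x) = 0" for u :: "real ^ 'n"
proof -
  have "(\<Sum>x\<in>cube. u \<bullet> x) = (\<Sum>x\<in>cube. u \<bullet> (- x))"
    by (rule sum.reindex_bij_witness[where i = uminus and j = uminus])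
      (auto simp: cube_def minus_equation_iff[of _ 1])
  then show ?thesis
    by (simp add: sum_negf)
qed

lemma punctured_cube_fun_correlation:
  "(\<Sum>x :: real ^ 'n \<in> cube. punctured_cube_fun x * ((\<chi> i. 1) \<bullet> x)) = 2 * real CARD('n)"
proof -
  let ?u = "(\<chi> i. 1) :: real ^ 'n"
  have "(\<Sum>x\<in>cube. punctured_cube_fun x * (?u \<bullet> x))
      = (\<Sum>x\<in>cube. ?u \<bullet> x - (if x = puncture then 2 * (?u \<bullet> x) else 0))"
    by (rule sum.cong) (auto simp: punctured_cube_fun_def)
  also have "\<dots> = - (2 * (?u \<bullet> puncture))"
    by (simp add: sum_subtractf sum_cube_inner finite_cube puncture_in_cube)
  also have "\<dots> = 2 * real CARD('n)"
    by (simp add: inner_vec_def)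
  finally show ?thesis .
qed

lemma beckmann_punctured_cube_fun:
  "beckmann (punctured_cube_fun :: real ^ 'n \<Rightarrow> real) = sqrt (real CARD('n)) / 2 ^ CARD('n)"
  unfolding beckmann_def
proof (rule cInf_eq_minimum)
  define V :: "real ^ 'n \<Rightarrow> real ^ 'n" where "V x = (\<chi> i. (punctured_cube_fun x - 1) / 2)" for x
  \<comment> \<open>Adding a constant to \<open>f\<close> does not change its differences, so all coordinates of \<open>V\<close> can be
    \<open>(f - 1) / 2\<close>, which is supported at the puncture.\<close>
  have adm: "cube_div V x = cube_L punctured_cube_fun x" for x
    unfolding cube_div_def cube_L_def
    by (rule sum.cong) (simp_all add: V_def cube_D_def diff_divide_distrib)
  have "norm (V x) = (if x = puncture then sqrt (real CARD('n)) else 0)" for x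
    by (simp add: V_def norm_const_vec punctured_cube_fun_def)
  then have "cube_expectation (\<lambda>x. norm (V x)) = sqrt (real CARD('n)) / 2 ^ CARD('n)"
    by (simp add: cube_expectation_eq_sum finite_cube puncture_in_cube)
  with adm show "sqrt (real CARD('n)) / 2 ^ CARD('n)
      \<in> {cube_expectation (\<lambda>x. norm (V x)) | V.
          \<forall>x\<in>cube. cube_div V x = cube_L (punctured_cube_fun :: real ^ 'n \<Rightarrow> real) x}"
    by (intro CollectI exI[of _ V]) simp
next
  fix b
  assume "b \<in> {cube_expectation (\<lambda>x. norm (V x)) | V.
          \<forall>x\<in>cube. cube_div V x = cube_L (punctured_cube_fun :: real ^ 'n \<Rightarrow> real) x}"
  then obtain V where b: "b = cube_expectation (\<lambda>x. norm (V x))"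
    and V: "\<forall>x\<in>cube. cube_div V x = cube_L (punctured_cube_fun :: real ^ 'n \<Rightarrow> real) x"
    by blast
  let ?s = "sqrt (real CARD('n))"
  have "2 * real CARD('n) / 2 ^ CARD('n) \<le> 2 * ?s * b"
    using linear_potential_bound[OF V, of "\<chi> i. 1"]
    by (simp add: b cube_expectation_eq_sum[of "\<lambda>x. _ x * _ x"]
        punctured_cube_fun_correlation norm_const_vec)
  moreover have "real CARD('n) = ?s * ?s"
    by simp
  ultimately have "2 * ?s * (?s / 2 ^ CARD('n)) \<le> 2 * ?s * b"
    by (metis mult.assoc times_divide_eq_right)
  then show "?s / 2 ^ CARD('n) \<le> b"
    by (rule mult_left_le_imp_le) simp
qed

section \<open>One-sided boundaries\<close>

lemma flip_eq_iff: "flip i x = y \<longleftrightarrow> x = flip i y"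
  by auto

lemma flip_puncture_neq: "flip i puncture \<noteq> puncture" "puncture \<noteq> flip i puncture"
  by (auto simp: flip_def vec_eq_iff)

lemma inj_flip_puncture: "inj (\<lambda>i. flip i puncture)"
  by (rule injI) (auto simp: flip_def vec_eq_iff split: if_splits)

lemma punctured_cube_fun_descent:
  "punctured_cube_fun x = 1 \<and> punctured_cube_fun (flip i x) = -1 \<longleftrightarrow> x = flip i puncture"
  by (auto simp: punctured_cube_fun_def flip_eq_iff flip_puncture_neq)

lemma punctured_cube_fun_ascent:
  "punctured_cube_fun x = -1 \<and> punctured_cube_fun (flip i x) = 1 \<longleftrightarrow> x = puncture"
  by (auto simp: punctured_cube_fun_def flip_eq_iff flip_puncture_neq)

lemma incident_edge_sensitive:
  assumes "x = flip i puncture \<or> x = puncture"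
  shows "{x, flip i x} \<in> sensitive_edges punctured_cube_fun"
proof -
  have "x \<in> cube"
    using assms puncture_in_cube flip_in_cube by blast
  moreover have "punctured_cube_fun x \<noteq> punctured_cube_fun (flip i x)"
    using assms by (auto simp: punctured_cube_fun_def flip_puncture_neq)
  ultimately show ?thesis
    unfolding sensitive_edges_def by blast
qed

text \<open>Distinct directions lead from the puncture to distinct neighbours, so the count is \<open>1\<close> at each
  of the \<open>n\<close> neighbours and \<open>0\<close> elsewhere, and the square root has no effect.\<close>

lemma expectation_sqrt_puncture_edges:
  "cube_expectation (\<lambda>x :: real ^ 'n. sqrt (real (card {i. x = flip i puncture})))
    = real CARD('n) / 2 ^ CARD('n)"
proof -
  let ?N = "range (\<lambda>i. flip i (puncture :: real ^ 'n))"
  have "(\<Sum>x :: real ^ 'n \<in> cube. sqrt (real (card {i. x = flip i puncture})))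
      = (\<Sum>x\<in>?N. sqrt (real (card {i. x = flip i puncture})))"
    by (rule sum.mono_neutral_right) (auto simp: finite_cube flip_in_cube puncture_in_cube)
  also have "\<dots> = (\<Sum>x\<in>?N. 1)"
  proof (rule sum.cong)
    fix x
    assume "x \<in> ?N"
    then obtain j where "x = flip j puncture"
      by blast
    then have "{i. x = flip i puncture} = {j}"
      using inj_flip_puncture by (auto simp: inj_def)
    then show "sqrt (real (card {i. x = flip i puncture})) = 1"
      by simp
  qed simp
  also have "\<dots> = real CARD('n)"
    by (simp add: card_image inj_flip_puncture)
  finally show ?thesis
    by (simp add: cube_expectation_eq_sum)
qed

lemma one_sided_boundary_punctured:
  assumes "x \<in> cube"
  shows "one_sided_boundary {x \<in> cube. punctured_cube_fun x = 1} x = card {i. x = flip i puncture}"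
proof -
  have "x \<in> {x \<in> cube. punctured_cube_fun x = 1}
      \<and> flip i x \<notin> {x \<in> cube. punctured_cube_fun x = 1} \<longleftrightarrow> x = flip i puncture" for i
    using assms flip_in_cube[OF assms, of i] punctured_cube_fun_descent[of x i]
    by (auto simp: punctured_cube_fun_def split: if_splits)
  then show ?thesis
    by (simp add: one_sided_boundary_def)
qed

lemma expectation_one_sided_boundary_punctured:
  "cube_expectation (\<lambda>x :: real ^ 'n.
      sqrt (real (one_sided_boundary {x \<in> cube. punctured_cube_fun x = 1} x)))
    = real CARD('n) / 2 ^ CARD('n)"
  unfolding expectation_sqrt_puncture_edges[symmetric]
  by (simp add: cube_expectation_eq_sum one_sided_boundary_punctured)

lemma T_col_all_red:
  fixes c :: "(real ^ 'n) set \<Rightarrow> colour"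
  assumes "\<forall>e\<in>sensitive_edges punctured_cube_fun. c e = Red"
  shows "T_col c punctured_cube_fun = real CARD('n) / 2 ^ CARD('n)"
proof -
  have "sens_red c punctured_cube_fun x = card {i. x = flip i puncture}" for x
    unfolding sens_red_def conj_assoc[symmetric] punctured_cube_fun_descent
    using assms incident_edge_sensitive[of x] by (metis (lifting))
  moreover have "sens_blue c punctured_cube_fun x = 0" for x
  proof -
    have "{i. x = puncture \<and> c {x, flip i x} = Blue} = {}"
      using assms incident_edge_sensitive[of x] by force
    then show ?thesis
      unfolding sens_blue_def conj_assoc[symmetric] punctured_cube_fun_ascent
      by (metis card.empty)
  qed
  ultimately show ?thesis
    by (simp add: T_col_def expectation_sqrt_puncture_edges cube_expectation_eq_sum[of "\<lambda>_. 0"])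
qed

lemma T_frac_one:
  fixes \<theta> :: "(real ^ 'n) set \<Rightarrow> real"
  assumes "\<forall>e\<in>sensitive_edges punctured_cube_fun. \<theta> e = 1"
  shows "T_frac \<theta> punctured_cube_fun = real CARD('n) / 2 ^ CARD('n)"
proof -
  have "(\<Sum>i | x = flip i puncture. (\<theta> {x, flip i x})\<^sup>2) = real (card {i. x = flip i puncture})" for x
  proof -
    have "(\<Sum>i | x = flip i puncture. (\<theta> {x, flip i x})\<^sup>2) = (\<Sum>i | x = flip i puncture. 1)"
    proof (rule sum.cong)
      fix i
      assume "i \<in> {i. x = flip i puncture}"
      then have "{x, flip i x} \<in> sensitive_edges punctured_cube_fun"
        by (intro incident_edge_sensitive) blast
      with assms show "(\<theta> {x, flip i x})\<^sup>2 = 1"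
        by simp
    qed simp
    then show ?thesis
      by simp
  qed
  moreover have "(\<Sum>i | x = puncture. (1 - \<theta> {x, flip i x})\<^sup>2) = 0" for x
    using assms incident_edge_sensitive[of x] by (intro sum.neutral) auto
  ultimately show ?thesis
    by (simp add: T_frac_def punctured_cube_fun_descent punctured_cube_fun_ascent
        expectation_sqrt_puncture_edges)
qed

section \<open>Comparison of the boundaries\<close>

theorem proposition5p2:
  fixes f :: "real ^ 'n \<Rightarrow> real" and A :: "(real ^ 'n) set"
  defines "f \<equiv> punctured_cube_fun"
  defines "A \<equiv> {x \<in> cube. f x = 1}"
  shows "beckmann f = sqrt (real CARD('n)) / 2 ^ CARD('n) \<and>
    cube_expectation (\<lambda>x. sqrt (real (one_sided_boundary A x))) = real CARD('n) / 2 ^ CARD('n) \<and>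
    (\<forall>c. (\<forall>e\<in>sensitive_edges f. c e = Red) \<longrightarrow>
       T_col c f = cube_expectation (\<lambda>x. sqrt (real (one_sided_boundary A x))) \<and>
       T_col c f = real CARD('n) / 2 ^ CARD('n)) \<and>
    cube_expectation (\<lambda>x. sqrt (real (one_sided_boundary A x))) / beckmann f = sqrt (real CARD('n)) \<and>
    (\<forall>\<theta>. (\<forall>e\<in>sensitive_edges f. \<theta> e = 1) \<longrightarrow> T_frac \<theta> f / beckmann f = sqrt (real CARD('n)))"
  unfolding A_def f_def
  by (simp add: beckmann_punctured_cube_fun expectation_one_sided_boundary_punctured
      T_col_all_red T_frac_one real_div_sqrt)

end
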